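(* Let $G$ be a group and $(X,\mathcal I)$ an ideal $G$-space such that $\mathsf{sis}_{123}(B)=0$ for all $B\in\mathcal I$. For any partition $X=A_1\cup\dots\cup A_n$ some cell $A_i$ of the partition has $\mathrm{cov}\big(\Delta_{\mathcal I}(A_i)^{\wr E}\big)\le n$ for some finite set $E\subset G$.
   Context: A $G$-space is a set $X$ with a left action of $G$. A Boolean ideal on $X$ is a non-empty family $\mathcal I$ of subsets of $X$ such that $A\cup B\in\mathcal I$ and $A\cap C\in\mathcal I$ for all $A,B\in\mathcal I$, $C\subset X$; it is non-trivial if it is not the family of all subsets of $X$, and $G$-invariant if $gA\in\mathcal I$ for all $A\in\mathcal I$, $g\in G$. An ideal $G$-space is a pair $(X,\mathcal I)$ of a $G$-space $X$ and a non-trivial $G$-invariant Boolean ideal $\mathcal I$ on $X$. Put $\Delta_{\mathcal I}(A)=\{x\in G:A\cap xA\notin\mathcal I\}$ for $A\subset X$. For $D\subset G$ and $E\subset G$ put $D^{\wr E}=\bigcup_{x\in E}x^{-1}Dx$. For non-empty $B\subset G$, $\mathrm{cov}(B)=\min\{|F|:F\subset G,\ G=FB\}$. $P_\omega(Y)$ denotes the set of finitely supported probability measures on a set $Y$ (finite convex combinations of Dirac measures $\delta_y$). For $\mu=\sum_i\alpha_i\delta_{a_i}\in P_\omega(G)$ and $\nu=\sum_j\beta_j\delta_{x_j}$ in $P_\omega(G)$ or $P_\omega(X)$, $\mu*\nu=\sum_{i,j}\alpha_i\beta_j\delta_{a_ix_j}$. For $A\subset X$, $$\mathsf{sis}_{123}(A)=\sup_{\mu_1\in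 P_\omega(G)}\ \inf_{\mu_2\in P_\omega(G)}\ \sup_{\mu_3\in P_\omega(X)}\mu_1*\mu_2*\mu_3(A).$$ *)

theory Defs
  imports
    "HOL-Algebra.Group_Action"
    "HOL-Probability.Probability_Mass_Function"
    "HOL-Library.Extended_Nat"
begin

definition boolean_ideal :: "'x set \<Rightarrow> 'x set set \<Rightarrow> bool" where
  "boolean_ideal X \<I> \<longleftrightarrow>
     \<I> \<subseteq> Pow X \<and> \<I> \<noteq> {} \<and>
     (\<forall>A\<in>\<I>. \<forall>B\<in>\<I>. A \<union> B \<in> \<I>) \<and>
     (\<forall>A\<in>\<I>. \<forall>C. C \<subseteq> X \<longrightarrow> A \<inter> C \<in> \<I>)"

locale ideal_G_space = group_action G X \<phi>
  for G (structure) and X :: "'x set" and \<phi> +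
  fixes \<I> :: "'x set set"
  assumes boolean_ideal: "boolean_ideal X \<I>"
    and nontrivial: "\<I> \<noteq> Pow X"
    and invariant: "\<lbrakk>A \<in> \<I>; g \<in> carrier G\<rbrakk> \<Longrightarrow> \<phi> g ` A \<in> \<I>"

definition ideal_Delta ::
  "('g, 'b) monoid_scheme \<Rightarrow> ('g \<Rightarrow> 'x \<Rightarrow> 'x) \<Rightarrow> 'x set set \<Rightarrow> 'x set \<Rightarrow> 'g set" where
  "ideal_Delta G \<phi> \<I> A = {x \<in> carrier G. A \<inter> \<phi> x ` A \<notin> \<I>}"

definition wreath_conj ::
  "('g, 'b) monoid_scheme \<Rightarrow> 'g set \<Rightarrow> 'g set \<Rightarrow> 'g set" where
  "wreath_conj G D E = (\<Union>x\<in>E. {inv\<^bsub>G\<^esub> x \<otimes>\<^bsub>G\<^esub> d \<otimes>\<^bsub>G\<^esub> x | d. d \<in> D})"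

definition set_size :: "'a set \<Rightarrow> enat" where
  "set_size F = (if finite F then enat (card F) else \<infinity>)"

text \<open>All infinite cardinals are identified with \<open>\<infinity>\<close>, which does not affect comparisons with
  natural numbers. For empty \<open>B\<close> no \<open>F\<close> qualifies and the value is \<open>\<infinity>\<close>, so a finite upper bound
  on \<open>cov G B\<close> entails that \<open>B\<close> is non-empty.\<close>
definition cov :: "('g, 'b) monoid_scheme \<Rightarrow> 'g set \<Rightarrow> enat" where
  "cov G B = (INF F \<in> {F. F \<subseteq> carrier G \<and> carrier G = F <#>\<^bsub>G\<^esub> B}. set_size F)"

definition fin_prob :: "'a set \<Rightarrow> 'a pmf set" where
  "fin_prob Y = {p. finite (set_pmf p) \<and> set_pmf p \<subseteq> Y}"

definition pmf_convolution ::
  "('g \<Rightarrow> 'x \<Rightarrow> 'y) \<Rightarrow> 'g pmf \<Rightarrow> 'x pmf \<Rightarrow> 'y pmf" where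
  "pmf_convolution f \<mu> \<nu> = map_pmf (\<lambda>(a, x). f a x) (pair_pmf \<mu> \<nu>)"

text \<open>The suprema and infima are those of the reals. For a group \<open>G\<close> acting on a non-empty set \<open>X\<close>
  they range over non-empty families with values in the unit interval; a space carrying a
  non-trivial ideal is always non-empty.\<close>
definition sis123 ::
  "('g, 'b) monoid_scheme \<Rightarrow> 'x set \<Rightarrow> ('g \<Rightarrow> 'x \<Rightarrow> 'x) \<Rightarrow> 'x set \<Rightarrow> real" where
  "sis123 G X \<phi> A =
     (SUP \<mu>1 \<in> fin_prob (carrier G). INF \<mu>2 \<in> fin_prob (carrier G). SUP \<mu>3 \<in> fin_prob X.
        measure_pmf.prob
          (pmf_convolution \<phi> (pmf_convolution (\<lambda>a b. a \<otimes>\<^bsub>G\<^esub> b) \<mu>1 \<mu>2) \<mu>3) A)"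

end

theory Submission
  imports Defs
begin

text \<open>
  The density \<open>sis123\<close> is subadditive: if \<open>\<mu>2\<close> is good for \<open>A\<close> against \<open>\<mu>1\<close> and \<open>\<mu>2'\<close> is good for \<open>B\<close>
  against \<open>\<mu>1 * \<mu>2\<close>, then \<open>\<mu>2 * \<mu>2'\<close> is good for both, because right convolution only averages over
  starting points. Hence some cell \<open>A\<close> has density at least \<open>1/n\<close>, and there is \<open>\<mu>1\<close> such that no
  \<open>\<mu>2\<close> brings the value for \<open>A\<close> below some \<open>c > 1/(n+1)\<close>. Let \<open>E\<close> be the support of \<open>\<mu>1\<close> and
  \<open>D = \<Delta>(A)\<^sup>\<wr>\<^sup>E\<close>. If \<open>F\<close> is finite and \<open>h\<inverse>k \<notin> D\<close> for distinct \<open>h, k \<in> F\<close>, then for each \<open>e \<in> E\<close> the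
  sets \<open>he\<inverse>A\<close> with \<open>h \<in> F\<close> are disjoint outside a set \<open>B\<close> of the ideal, so the uniform measure on
  \<open>F\<inverse>\<close>, convolved with a measure that is small on \<open>B\<close>, gives a value at most \<open>1/|F| + \<epsilon>\<close>. Therefore
  \<open>|F| \<le> n\<close>, and a maximal such \<open>F\<close> satisfies \<open>G = FD\<close>.
\<close>

section \<open>Convolutions as mixtures of distributions\<close>

lemma pmf_convolution_bind_left:
  "pmf_convolution f \<mu> \<nu> = bind_pmf \<mu> (\<lambda>a. map_pmf (f a) \<nu>)"
  by (simp add: pmf_convolution_def pair_pmf_def map_bind_pmf map_pmf_def bind_return_pmf
      bind_assoc_pmf)

lemma pmf_convolution_bind_right:
  "pmf_convolution f \<mu> \<nu> = bind_pmf \<nu> (\<lambda>x. map_pmf (\<lambda>a. f a x) \<mu>)"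
  unfolding pmf_convolution_bind_left map_pmf_def by (rule bind_commute_pmf)

lemma prob_bind_pmf:
  "measure_pmf.prob (bind_pmf \<nu> f) A = measure_pmf.expectation \<nu> (\<lambda>k. measure_pmf.prob (f k) A)"
proof -
  have "emeasure (bind_pmf \<nu> f) A = (\<integral>\<^sup>+k. emeasure (f k) A \<partial>\<nu>)"
    by (rule emeasure_bind_pmf)
  also have "\<dots> = (\<integral>\<^sup>+k. ennreal (measure_pmf.prob (f k) A) \<partial>\<nu>)"
    by (simp only: measure_pmf.emeasure_eq_measure)
  also have "\<dots> = ennreal (measure_pmf.expectation \<nu> (\<lambda>k. measure_pmf.prob (f k) A))"
    by (intro nn_integral_eq_integral measure_pmf.integrable_const_bound[where B = 1]) auto
  finally show ?thesis
    by (simp add: measure_pmf.emeasure_eq_measure)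
qed

text \<open>\<open>B\<close> collects the exceptional points: off \<open>B\<close> the bound
  \<open>c\<close> holds, on \<open>B\<close> only \<open>c + 1\<close>, and averaging weights the
  excess by the mass of \<open>B\<close>.\<close>

lemma prob_bind_pmf_le_add:
  assumes "\<And>k. k \<in> set_pmf \<nu> \<Longrightarrow> measure_pmf.prob (f k) A \<le> c + indicator B k"
  shows "measure_pmf.prob (bind_pmf \<nu> f) A \<le> c + measure_pmf.prob \<nu> B"
proof -
  have "measure_pmf.prob (bind_pmf \<nu> f) A \<le> measure_pmf.expectation \<nu> (\<lambda>k. c + indicator B k)"
    unfolding prob_bind_pmf
  proof (rule integral_mono_AE)
    show "integrable \<nu> (\<lambda>k. measure_pmf.prob (f k) A)"
      by (rule measure_pmf.integrable_const_bound[where B = 1]) auto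
    show "integrable \<nu> (\<lambda>k. c + indicator B k :: real)"
      by (intro Bochner_Integration.integrable_add integrable_real_indicator) (auto simp: measure_pmf.emeasure_eq_measure)
  qed (use assms in \<open>auto simp: AE_measure_pmf_iff\<close>)
  also have "\<dots> = c + measure_pmf.prob \<nu> B"
    by (subst Bochner_Integration.integral_add) (auto intro!: integrable_real_indicator simp: measure_pmf.emeasure_eq_measure)
  finally show ?thesis .
qed

lemma prob_bind_pmf_le:
  assumes "\<And>k. k \<in> set_pmf \<nu> \<Longrightarrow> measure_pmf.prob (f k) A \<le> c"
  shows "measure_pmf.prob (bind_pmf \<nu> f) A \<le> c"
  using prob_bind_pmf_le_add[of \<nu> f A c "{}"] assms by simp

lemma return_pmf_in_fin_prob: "y \<in> Y \<Longrightarrow> return_pmf y \<in> fin_prob Y"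
  by (simp add: fin_prob_def)

lemma fin_probD: "p \<in> fin_prob Y \<Longrightarrow> y \<in> set_pmf p \<Longrightarrow> y \<in> Y"
  by (auto simp: fin_prob_def)

section \<open>Ideals and the group action\<close>

context ideal_G_space
begin

lemma group_G: "group G"
  using group_hom group_hom.axioms(1) by blast

lemma space_nonempty: "X \<noteq> {}"
  using boolean_ideal nontrivial by (auto simp: boolean_ideal_def)

lemma ideal_union: "A \<in> \<I> \<Longrightarrow> B \<in> \<I> \<Longrightarrow> A \<union> B \<in> \<I>"
  using boolean_ideal by (simp add: boolean_ideal_def)

lemma ideal_subset: "B \<in> \<I> \<Longrightarrow> A \<subseteq> B \<Longrightarrow> A \<in> \<I>"
proof -
  assume B: "B \<in> \<I>" "A \<subseteq> B"
  then have "A \<subseteq> X" using boolean_ideal by (auto simp: boolean_ideal_def)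
  with B(1) have "B \<inter> A \<in> \<I>" using boolean_ideal by (simp add: boolean_ideal_def)
  with B(2) show "A \<in> \<I>" by (simp add: Int_absorb1)
qed

lemma ideal_empty: "{} \<in> \<I>"
proof -
  obtain B where "B \<in> \<I>" using boolean_ideal by (auto simp: boolean_ideal_def)
  then show ?thesis by (rule ideal_subset) simp
qed

lemma ideal_UN: "finite S \<Longrightarrow> (\<And>s. s \<in> S \<Longrightarrow> f s \<in> \<I>) \<Longrightarrow> (\<Union>s\<in>S. f s) \<in> \<I>"
  by (induction S rule: finite_induct) (auto simp: ideal_empty ideal_union)

lemma action_closed: "g \<in> carrier G \<Longrightarrow> x \<in> X \<Longrightarrow> \<phi> g x \<in> X"
  using element_image by blast

lemma action_one: "x \<in> X \<Longrightarrow> \<phi> \<one> x = x"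
  using id_eq_one by (metis restrict_apply')

lemma image_action_mult:
  assumes "A \<subseteq> X" "g \<in> carrier G" "h \<in> carrier G"
  shows "\<phi> (g \<otimes> h) ` A = \<phi> g ` \<phi> h ` A"
  unfolding image_image using assms by (intro image_cong) (auto simp: composition_rule)

lemma image_action_one: "A \<subseteq> X \<Longrightarrow> \<phi> \<one> ` A = A"
  by (force simp: action_one)

section \<open>Convolution on the group and the distribution of a randomly moved point\<close>

lemma mult_in_fin_prob:
  assumes "\<mu> \<in> fin_prob (carrier G)" "\<nu> \<in> fin_prob (carrier G)"
  shows "pmf_convolution (\<otimes>) \<mu> \<nu> \<in> fin_prob (carrier G)"
proof -
  interpret group G by (rule group_G)
  show ?thesis
    using assms by (auto simp: fin_prob_def pmf_convolution_def)
qed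

lemma mult_pmf_assoc:
  assumes "\<mu> \<in> fin_prob (carrier G)" "\<nu> \<in> fin_prob (carrier G)" "\<rho> \<in> fin_prob (carrier G)"
  shows "pmf_convolution (\<otimes>) (pmf_convolution (\<otimes>) \<mu> \<nu>) \<rho> =
         pmf_convolution (\<otimes>) \<mu> (pmf_convolution (\<otimes>) \<nu> \<rho>)"
proof -
  interpret group G by (rule group_G)
  show ?thesis
    unfolding pmf_convolution_bind_left bind_assoc_pmf map_bind_pmf bind_map_pmf pmf.map_comp o_def
    using assms by (intro bind_pmf_cong map_pmf_cong refl) (auto dest!: fin_probD simp: m_assoc)
qed

text \<open>This is the convolution of \<open>\<mu>\<close> with the Dirac measure at
  \<open>x\<close>; such starting measures determine the supremum over
  \<open>\<mu>3\<close>.\<close>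

abbreviation orbit_pmf :: "'a pmf \<Rightarrow> 'x \<Rightarrow> 'x pmf" where
  "orbit_pmf \<mu> x \<equiv> map_pmf (\<lambda>g. \<phi> g x) \<mu>"

text \<open>The right factor moves the point first, so \<open>\<nu>\<close> only randomizes the
  starting point of \<open>\<mu>\<close>. Hence bounds uniform in the starting point survive right
  convolution.\<close>

lemma orbit_pmf_mult_right:
  assumes "\<mu> \<in> fin_prob (carrier G)" "\<nu> \<in> fin_prob (carrier G)" "x \<in> X"
  shows "orbit_pmf (pmf_convolution (\<otimes>) \<mu> \<nu>) x = bind_pmf (orbit_pmf \<nu> x) (orbit_pmf \<mu>)"
  unfolding pmf_convolution_bind_right map_bind_pmf bind_map_pmf pmf.map_comp o_def
  using assms by (intro bind_pmf_cong map_pmf_cong refl) (auto dest!: fin_probD simp: composition_rule)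

text \<open>Here one conditions on the factor that acts last, so that estimates can treat one
  \<open>e\<close> in the support of \<open>\<mu>\<close> at a time.\<close>

lemma orbit_pmf_mult_left:
  assumes "\<mu> \<in> fin_prob (carrier G)" "\<nu> \<in> fin_prob (carrier G)" "x \<in> X"
  shows "orbit_pmf (pmf_convolution (\<otimes>) \<mu> \<nu>) x =
         bind_pmf \<mu> (\<lambda>e. map_pmf (\<lambda>k. \<phi> e (\<phi> k x)) \<nu>)"
  unfolding pmf_convolution_bind_left map_bind_pmf bind_map_pmf pmf.map_comp o_def
  using assms by (intro bind_pmf_cong map_pmf_cong refl) (auto dest!: fin_probD simp: composition_rule)

lemma orbit_pmf_subset:
  assumes "\<mu> \<in> fin_prob (carrier G)" "x \<in> X"
  shows "set_pmf (orbit_pmf \<mu> x) \<subseteq> X"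
  using assms by (auto dest!: fin_probD simp: action_closed)

lemma prob_orbit_pmf_mult_le:
  assumes "\<mu> \<in> fin_prob (carrier G)" "\<nu> \<in> fin_prob (carrier G)" "x \<in> X"
    and "\<And>y. y \<in> X \<Longrightarrow> measure_pmf.prob (orbit_pmf \<mu> y) A \<le> c"
  shows "measure_pmf.prob (orbit_pmf (pmf_convolution (\<otimes>) \<mu> \<nu>) x) A \<le> c"
  unfolding orbit_pmf_mult_right[OF assms(1-3)]
  using assms(4) orbit_pmf_subset[OF assms(2,3)] by (intro prob_bind_pmf_le) blast

section \<open>The inner supremum, and strategies extracted from the density\<close>

definition peak :: "'x set \<Rightarrow> 'a pmf \<Rightarrow> real" where
  "peak A \<mu> = (SUP \<mu>3 \<in> fin_prob X. measure_pmf.prob (pmf_convolution \<phi> \<mu> \<mu>3) A)"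

lemma sis123_peak:
  "sis123 G X \<phi> A = (SUP \<mu>1 \<in> fin_prob (carrier G). INF \<mu>2 \<in> fin_prob (carrier G).
     peak A (pmf_convolution (\<otimes>) \<mu>1 \<mu>2))"
  unfolding sis123_def peak_def ..

lemma fin_prob_space_nonempty: "fin_prob X \<noteq> {}"
proof -
  obtain x where "x \<in> X" using space_nonempty by blast
  from return_pmf_in_fin_prob[OF this] show ?thesis by blast
qed

lemma one_in_fin_prob: "return_pmf \<one> \<in> fin_prob (carrier G)"
  by (intro return_pmf_in_fin_prob monoid.one_closed group.is_monoid group_G)

lemma fin_prob_group_nonempty: "fin_prob (carrier G) \<noteq> {}"
  using one_in_fin_prob by blast

text \<open>A general \<open>\<mu>3\<close> averages over starting points, so it cannot exceed a
  bound valid for every single point.\<close>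

lemma peak_le:
  assumes "\<And>x. x \<in> X \<Longrightarrow> measure_pmf.prob (orbit_pmf \<mu> x) A \<le> c"
  shows "peak A \<mu> \<le> c"
  unfolding peak_def pmf_convolution_bind_right using fin_prob_space_nonempty assms
  by (intro cSUP_least prob_bind_pmf_le) (auto dest: fin_probD)

lemma bdd_above_peak: "bdd_above ((\<lambda>\<mu>3. measure_pmf.prob (pmf_convolution \<phi> \<mu> \<mu>3) A) ` fin_prob X)"
  by (rule bdd_aboveI[where M = 1]) auto

lemma prob_orbit_pmf_le_peak:
  assumes "x \<in> X"
  shows "measure_pmf.prob (orbit_pmf \<mu> x) A \<le> peak A \<mu>"
proof -
  have "orbit_pmf \<mu> x = pmf_convolution \<phi> \<mu> (return_pmf x)"
    by (simp add: pmf_convolution_bind_right bind_return_pmf)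
  then show ?thesis
    unfolding peak_def using assms
    by (simp only:) (rule cSUP_upper[OF return_pmf_in_fin_prob bdd_above_peak])
qed

lemma peak_nonneg: "0 \<le> peak A \<mu>"
proof -
  obtain x where "x \<in> X" using space_nonempty by blast
  from prob_orbit_pmf_le_peak[OF this] show ?thesis
    by (rule order_trans[OF measure_nonneg])
qed

lemma peak_le_one: "peak A \<mu> \<le> 1"
  by (rule peak_le) simp

lemma bdd_below_peak_mult: "bdd_below ((\<lambda>\<mu>2. peak A (f \<mu>2)) ` S)"
  by (rule bdd_belowI[where m = 0]) (auto simp: peak_nonneg)

text \<open>The reals are only conditionally complete, so each supremum and infimum comes with its
  bound. Each infimum is at most the value at the Dirac measure of \<open>\<one>\<close>, hence at
  most 1.\<close>

lemma bdd_above_INF_peak: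
  "bdd_above ((\<lambda>\<mu>1. INF \<mu>2\<in>fin_prob (carrier G). peak A (pmf_convolution (\<otimes>) \<mu>1 \<mu>2)) ` S)"
  by (rule bdd_aboveI[where M = 1])
    (auto intro!: cINF_lower2[OF bdd_below_peak_mult one_in_fin_prob] peak_le_one)

lemma sis123_le:
  assumes "\<And>\<mu>1. \<mu>1 \<in> fin_prob (carrier G) \<Longrightarrow> \<exists>\<mu>2\<in>fin_prob (carrier G). \<forall>x\<in>X.
    measure_pmf.prob (orbit_pmf (pmf_convolution (\<otimes>) \<mu>1 \<mu>2) x) A \<le> c"
  shows "sis123 G X \<phi> A \<le> c"
  unfolding sis123_peak
proof (rule cSUP_least[OF fin_prob_group_nonempty])
  fix \<mu>1 assume "\<mu>1 \<in> fin_prob (carrier G)"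
  from assms[OF this] obtain \<mu>2 where "\<mu>2 \<in> fin_prob (carrier G)"
    "\<forall>x\<in>X. measure_pmf.prob (orbit_pmf (pmf_convolution (\<otimes>) \<mu>1 \<mu>2) x) A \<le> c" by blast
  then show "(INF \<mu>2\<in>fin_prob (carrier G). peak A (pmf_convolution (\<otimes>) \<mu>1 \<mu>2)) \<le> c"
    by (intro cINF_lower2[OF bdd_below_peak_mult] peak_le) auto
qed

lemma sis123_less_obtain:
  assumes "sis123 G X \<phi> A < c" "\<mu>1 \<in> fin_prob (carrier G)"
  obtains \<mu>2 where "\<mu>2 \<in> fin_prob (carrier G)"
    "\<And>x. x \<in> X \<Longrightarrow> measure_pmf.prob (orbit_pmf (pmf_convolution (\<otimes>) \<mu>1 \<mu>2) x) A < c"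
proof -
  have "(INF \<mu>2\<in>fin_prob (carrier G). peak A (pmf_convolution (\<otimes>) \<mu>1 \<mu>2)) < c"
    using assms(1) cSUP_upper[OF assms(2) bdd_above_INF_peak, of A]
    unfolding sis123_peak by linarith
  then obtain \<mu>2 where "\<mu>2 \<in> fin_prob (carrier G)" "peak A (pmf_convolution (\<otimes>) \<mu>1 \<mu>2) < c"
    by (subst (asm) cINF_less_iff[OF fin_prob_group_nonempty bdd_below_peak_mult]) blast
  with that show thesis
    using prob_orbit_pmf_le_peak le_less_trans by blast
qed

text \<open>\<open>d\<close> is the infimum over \<open>\<mu>2\<close> for the chosen
  \<open>\<mu>1\<close>. The gap between \<open>c\<close> and \<open>d\<close> keeps strictness when
  \<open>d\<close> is later bounded above only weakly.\<close>

lemma less_sis123_obtain: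
  assumes "c < sis123 G X \<phi> A"
  obtains \<mu>1 d where "\<mu>1 \<in> fin_prob (carrier G)" "c < d"
    "\<And>\<mu>2. \<mu>2 \<in> fin_prob (carrier G) \<Longrightarrow> d \<le> peak A (pmf_convolution (\<otimes>) \<mu>1 \<mu>2)"
proof -
  from assms obtain \<mu>1 where \<mu>1: "\<mu>1 \<in> fin_prob (carrier G)"
    and less: "c < (INF \<mu>2\<in>fin_prob (carrier G). peak A (pmf_convolution (\<otimes>) \<mu>1 \<mu>2))"
    unfolding sis123_peak
    by (subst (asm) less_cSUP_iff[OF fin_prob_group_nonempty bdd_above_INF_peak]) blast
  show thesis
    by (rule that[OF \<mu>1 less]) (rule cINF_lower[OF bdd_below_peak_mult])
qed

section \<open>Subadditivity and normalization of the density\<close>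

lemma sis123_Un_le: "sis123 G X \<phi> (A \<union> B) \<le> sis123 G X \<phi> A + sis123 G X \<phi> B"
proof (rule field_le_epsilon)
  fix \<epsilon> :: real assume "0 < \<epsilon>"
  then have less: "sis123 G X \<phi> C < sis123 G X \<phi> C + \<epsilon> / 2" for C by simp
  show "sis123 G X \<phi> (A \<union> B) \<le> sis123 G X \<phi> A + sis123 G X \<phi> B + \<epsilon>"
  proof (rule sis123_le)
    fix \<mu>1 assume \<mu>1: "\<mu>1 \<in> fin_prob (carrier G)"
    obtain \<mu> where \<mu>: "\<mu> \<in> fin_prob (carrier G)" and A: "\<And>x. x \<in> X \<Longrightarrow>
        measure_pmf.prob (orbit_pmf (pmf_convolution (\<otimes>) \<mu>1 \<mu>) x) A < sis123 G X \<phi> A + \<epsilon> / 2"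
      using sis123_less_obtain[OF less \<mu>1] by metis
    let ?\<mu> = "pmf_convolution (\<otimes>) \<mu>1 \<mu>"
    have \<mu>': "?\<mu> \<in> fin_prob (carrier G)" by (rule mult_in_fin_prob[OF \<mu>1 \<mu>])
    \<comment> \<open>\<open>\<nu>\<close> answers the product that already contains
      \<open>\<mu>\<close>; placed on its right, it cannot spoil the bound for
      \<open>A\<close>.\<close>
    obtain \<nu> where \<nu>: "\<nu> \<in> fin_prob (carrier G)" and B: "\<And>x. x \<in> X \<Longrightarrow>
        measure_pmf.prob (orbit_pmf (pmf_convolution (\<otimes>) ?\<mu> \<nu>) x) B < sis123 G X \<phi> B + \<epsilon> / 2"
      using sis123_less_obtain[OF less \<mu>'] by metis
    have "measure_pmf.prob (orbit_pmf (pmf_convolution (\<otimes>) \<mu>1 (pmf_convolution (\<otimes>) \<mu> \<nu>)) x) (A \<union> B)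
        \<le> sis123 G X \<phi> A + sis123 G X \<phi> B + \<epsilon>" if "x \<in> X" for x
    proof -
      let ?p = "orbit_pmf (pmf_convolution (\<otimes>) ?\<mu> \<nu>) x"
      have "measure_pmf.prob ?p A \<le> sis123 G X \<phi> A + \<epsilon> / 2"
        using A by (intro prob_orbit_pmf_mult_le[OF \<mu>' \<nu> that] less_imp_le)
      moreover have "measure_pmf.prob ?p (A \<union> B) \<le> measure_pmf.prob ?p A + measure_pmf.prob ?p B"
        by (rule measure_Un_le) auto
      ultimately show ?thesis
        using B[OF that] unfolding mult_pmf_assoc[OF \<mu>1 \<mu> \<nu>] by linarith
    qed
    then show "\<exists>\<mu>2\<in>fin_prob (carrier G). \<forall>x\<in>X. measure_pmf.prob
        (orbit_pmf (pmf_convolution (\<otimes>) \<mu>1 \<mu>2) x) (A \<union> B) \<le> sis123 G X \<phi> A + sis123 G X \<phi> B + \<epsilon>"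
      using mult_in_fin_prob[OF \<mu> \<nu>] by blast
  qed
qed

lemma sis123_empty_le: "sis123 G X \<phi> {} \<le> 0"
  by (rule sis123_le) (use one_in_fin_prob in auto)

lemma sis123_UN_le:
  "finite S \<Longrightarrow> sis123 G X \<phi> (\<Union>i\<in>S. A i) \<le> (\<Sum>i\<in>S. sis123 G X \<phi> (A i))"
proof (induction S rule: finite_induct)
  case (insert i S)
  then show ?case
    using sis123_Un_le[of "A i" "\<Union>i\<in>S. A i"] by simp
qed (simp add: sis123_empty_le)

text \<open>Every distribution of a moved point lives on \<open>X\<close>, so no choice of
  \<open>\<mu>2\<close> lowers the mass of \<open>X\<close> below 1; the Dirac measure at
  \<open>\<one>\<close> as \<open>\<mu>1\<close> already shows this.\<close>

lemma sis123_space_ge: "1 \<le> sis123 G X \<phi> X"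
proof (rule ccontr)
  assume "\<not> ?thesis"
  then have "sis123 G X \<phi> X < 1" by simp
  then obtain \<mu> where \<mu>: "\<mu> \<in> fin_prob (carrier G)" and less: "\<And>x. x \<in> X \<Longrightarrow>
      measure_pmf.prob (orbit_pmf (pmf_convolution (\<otimes>) (return_pmf \<one>) \<mu>) x) X < 1"
    using sis123_less_obtain one_in_fin_prob by metis
  obtain x where x: "x \<in> X" using space_nonempty by blast
  have "measure_pmf.prob (orbit_pmf (pmf_convolution (\<otimes>) (return_pmf \<one>) \<mu>) x) X = 1"
    using orbit_pmf_subset[OF mult_in_fin_prob[OF one_in_fin_prob \<mu>] x]
    by (intro measure_pmf.prob_eq_1[THEN iffD2]) (auto simp: AE_measure_pmf_iff simp del: set_map_pmf)
  with less[OF x] show False by simp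
qed

section \<open>Difference sets, their conjugates, and intersections of translates\<close>

lemma inv_mem_ideal_Delta:
  assumes "A \<subseteq> X" "g \<in> ideal_Delta G \<phi> \<I> A"
  shows "inv g \<in> ideal_Delta G \<phi> \<I> A"
proof -
  interpret group G by (rule group_G)
  have g: "g \<in> carrier G" and notin: "A \<inter> \<phi> g ` A \<notin> \<I>"
    using assms(2) by (auto simp: ideal_Delta_def)
  \<comment> \<open>Translation by \<open>g\<close> carries the intersection belonging to
    \<open>inv g\<close> to the one belonging to \<open>g\<close>; invariance of the ideal then
    transfers non-membership.\<close>
  have "\<phi> g ` (A \<inter> \<phi> (inv g) ` A) = \<phi> g ` A \<inter> \<phi> g ` \<phi> (inv g) ` A"
    using inj_prop[OF g] surj_prop[of "inv g"] g assms(1) by (intro inj_on_image_Int) auto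
  also have "\<phi> g ` \<phi> (inv g) ` A = A"
    using g assms(1) image_action_mult[of A g "inv g"] by (simp add: image_action_one)
  finally have "\<phi> g ` (A \<inter> \<phi> (inv g) ` A) \<notin> \<I>"
    using notin by (simp add: Int_commute)
  then show ?thesis
    using g invariant by (auto simp: ideal_Delta_def)
qed

lemma mem_wreath_conj_iff:
  assumes "D \<subseteq> carrier G" "E \<subseteq> carrier G" "g \<in> carrier G"
  shows "g \<in> wreath_conj G D E \<longleftrightarrow> (\<exists>e\<in>E. e \<otimes> g \<otimes> inv e \<in> D)"
proof -
  interpret group G by (rule group_G)
  have eq: "g = inv e \<otimes> d \<otimes> e \<longleftrightarrow> d = e \<otimes> g \<otimes> inv e" if "e \<in> carrier G" "d \<in> carrier G" for e d
  proof
    assume "g = inv e \<otimes> d \<otimes> e"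
    then show "d = e \<otimes> g \<otimes> inv e"
      using that by (simp add: m_assoc) (simp add: m_assoc[symmetric])
  next
    assume "d = e \<otimes> g \<otimes> inv e"
    then show "g = inv e \<otimes> d \<otimes> e"
      using that assms(3) by (simp add: m_assoc) (simp add: m_assoc[symmetric])
  qed
  have "g \<in> wreath_conj G D E \<longleftrightarrow> (\<exists>e\<in>E. \<exists>d\<in>D. g = inv e \<otimes> d \<otimes> e)"
    by (auto simp: wreath_conj_def)
  also have "\<dots> \<longleftrightarrow> (\<exists>e\<in>E. \<exists>d\<in>D. d = e \<otimes> g \<otimes> inv e)"
    using assms(1,2) by (intro bex_cong refl eq) auto
  finally show ?thesis by simp
qed

text \<open>The inverse of a conjugate is the conjugate of the inverse by the same \<open>e\<close>,
  so the symmetry of the difference set passes to the union of conjugates.\<close>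

lemma inv_mem_wreath_conj:
  assumes "A \<subseteq> X" "E \<subseteq> carrier G" "g \<in> carrier G"
    and "g \<in> wreath_conj G (ideal_Delta G \<phi> \<I> A) E"
  shows "inv g \<in> wreath_conj G (ideal_Delta G \<phi> \<I> A) E"
proof -
  interpret group G by (rule group_G)
  have sub: "ideal_Delta G \<phi> \<I> A \<subseteq> carrier G" by (auto simp: ideal_Delta_def)
  obtain e where e: "e \<in> E" "e \<otimes> g \<otimes> inv e \<in> ideal_Delta G \<phi> \<I> A"
    using assms(4) mem_wreath_conj_iff[OF sub assms(2,3)] by blast
  have "inv (e \<otimes> g \<otimes> inv e) = e \<otimes> inv g \<otimes> inv e"
    using e(1) assms(2,3) by (auto simp: inv_mult_group m_assoc subset_iff)
  then have "e \<otimes> inv g \<otimes> inv e \<in> ideal_Delta G \<phi> \<I> A"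
    using inv_mem_ideal_Delta[OF assms(1) e(2)] by simp
  then show ?thesis
    using mem_wreath_conj_iff[OF sub assms(2) inv_closed[OF assms(3)]] e(1) by blast
qed

lemma translates_Int_in_ideal:
  assumes "A \<subseteq> X" "h \<in> carrier G" "k \<in> carrier G" "e \<in> carrier G"
    and "e \<otimes> (inv h \<otimes> k) \<otimes> inv e \<notin> ideal_Delta G \<phi> \<I> A"
  shows "\<phi> (h \<otimes> inv e) ` A \<inter> \<phi> (k \<otimes> inv e) ` A \<in> \<I>"
proof -
  interpret group G by (rule group_G)
  define g where "g = e \<otimes> (inv h \<otimes> k) \<otimes> inv e"
  have g: "g \<in> carrier G" using assms by (simp add: g_def)
  have he: "h \<otimes> inv e \<in> carrier G" using assms by simp
  have "h \<otimes> inv e \<otimes> g = k \<otimes> inv e"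
  proof -
    have "h \<otimes> inv e \<otimes> g = h \<otimes> (inv e \<otimes> e) \<otimes> inv h \<otimes> k \<otimes> inv e"
      using assms(2-4) by (simp only: g_def m_assoc m_closed inv_closed)
    then show ?thesis using assms(2-4) by simp
  qed
  then have eq: "\<phi> (k \<otimes> inv e) ` A = \<phi> (h \<otimes> inv e) ` \<phi> g ` A"
    using image_action_mult[OF assms(1) he g] by simp
  have "A \<inter> \<phi> g ` A \<in> \<I>"
    using assms(5) g by (simp add: ideal_Delta_def g_def)
  from invariant[OF this he] show ?thesis
    unfolding eq using inj_prop[OF he] surj_prop[OF g] assms(1)
    by (subst (asm) inj_on_image_Int[of _ X]) auto
qed

lemma mem_translate:
  assumes "x \<in> X" "h \<in> carrier G" "e \<in> carrier G" "\<phi> e (\<phi> (inv h) x) \<in> A"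
  shows "x \<in> \<phi> (h \<otimes> inv e) ` A"
proof -
  interpret group G by (rule group_G)
  let ?y = "\<phi> e (\<phi> (inv h) x)"
  have y: "?y \<in> X" using assms action_closed by simp
  have "\<phi> (h \<otimes> inv e) ?y = \<phi> h (\<phi> (inv e) ?y)"
    using assms y by (simp add: composition_rule)
  also have "\<phi> (inv e) ?y = \<phi> (inv h) x"
    using assms by (intro orbit_sym_aux) (auto simp: action_closed)
  also have "\<phi> h (\<phi> (inv h) x) = x"
    using assms composition_rule[of x h "inv h"] by (simp add: action_one)
  finally show ?thesis using assms(4) by force
qed

section \<open>Bounding the size of separated sets\<close>

lemma prob_uniform_inverse_le:
  assumes "\<mu> \<in> fin_prob (carrier G)" "finite F" "F \<noteq> {}" "F \<subseteq> carrier G" "x \<in> X"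
    and disj: "\<And>e h k. \<lbrakk>e \<in> set_pmf \<mu>; h \<in> F; k \<in> F; h \<noteq> k\<rbrakk> \<Longrightarrow>
      x \<notin> \<phi> (h \<otimes> inv e) ` A \<inter> \<phi> (k \<otimes> inv e) ` A"
  shows "measure_pmf.prob
    (orbit_pmf (pmf_convolution (\<otimes>) \<mu> (map_pmf (m_inv G) (pmf_of_set F))) x) A \<le> 1 / card F"
proof -
  interpret group G by (rule group_G)
  have \<nu>: "map_pmf (m_inv G) (pmf_of_set F) \<in> fin_prob (carrier G)"
    using assms(2-4) by (auto simp: fin_prob_def)
  show ?thesis
    unfolding orbit_pmf_mult_left[OF assms(1) \<nu> assms(5)] pmf.map_comp o_def
  proof (rule prob_bind_pmf_le)
    fix e assume e: "e \<in> set_pmf \<mu>"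
    then have e_G: "e \<in> carrier G" by (rule fin_probD[OF assms(1)])
    \<comment> \<open>Each \<open>h\<close> in \<open>?H\<close> puts \<open>x\<close> into the
      translate of \<open>A\<close> by \<open>h \<otimes> inv e\<close>. Since \<open>x\<close>
      avoids the pairwise intersections, at most one of the \<open>card F\<close> equally likely
      elements counts.\<close>
    let ?H = "F \<inter> {h. \<phi> e (\<phi> (inv h) x) \<in> A}"
    have "x \<in> \<phi> (h \<otimes> inv e) ` A" if "h \<in> ?H" for h
      using that assms(4) by (intro mem_translate assms(5) e_G) auto
    then have "h = k" if "h \<in> ?H" "k \<in> ?H" for h k
      using that disj[OF e, of h k] by (meson IntD1 IntI)
    then have "card ?H \<le> 1"
      using assms(2) by (simp add: card_le_Suc0_iff_eq)
    then show "measure_pmf.prob (map_pmf (\<lambda>h. \<phi> e (\<phi> (inv h) x)) (pmf_of_set F)) A \<le> 1 / card F"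
      using assms(2,3) by (simp add: measure_pmf_of_set vimage_def divide_right_mono)
  qed
qed

text \<open>The answer tested against \<open>\<mu>\<close> is the uniform measure on the inverses of
  \<open>F\<close>, followed on the right by a measure \<open>\<rho>\<close> that makes the
  exceptional set \<open>B\<close> improbable from every starting point.\<close>

lemma card_le_of_peak:
  assumes A: "A \<subseteq> X" and \<mu>: "\<mu> \<in> fin_prob (carrier G)"
    and null: "\<And>B. B \<in> \<I> \<Longrightarrow> sis123 G X \<phi> B \<le> 0"
    and c: "\<And>\<nu>. \<nu> \<in> fin_prob (carrier G) \<Longrightarrow> c \<le> peak A (pmf_convolution (\<otimes>) \<mu> \<nu>)"
    and F: "finite F" "F \<noteq> {}" "F \<subseteq> carrier G"
    and sep: "\<And>h k. \<lbrakk>h \<in> F; k \<in> F; h \<noteq> k\<rbrakk> \<Longrightarrow>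
      inv h \<otimes> k \<notin> wreath_conj G (ideal_Delta G \<phi> \<I> A) (set_pmf \<mu>)"
  shows "c \<le> 1 / card F"
proof (rule field_le_epsilon)
  interpret group G by (rule group_G)
  fix \<epsilon> :: real assume \<epsilon>: "0 < \<epsilon>"
  have E: "finite (set_pmf \<mu>)" "set_pmf \<mu> \<subseteq> carrier G"
    using \<mu> by (auto simp: fin_prob_def)
  \<comment> \<open>All overlaps of translates that could break the uniform estimate; finiteness of
    the support and of \<open>F\<close> keeps their union in the ideal.\<close>
  define B where "B = (\<Union>(e, h, k) \<in> set_pmf \<mu> \<times> {(h, k) \<in> F \<times> F. h \<noteq> k}.
    \<phi> (h \<otimes> inv e) ` A \<inter> \<phi> (k \<otimes> inv e) ` A)"
  have "B \<in> \<I>"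
    unfolding B_def
  proof (rule ideal_UN)
    have "{(h, k) \<in> F \<times> F. h \<noteq> k} \<subseteq> F \<times> F" by blast
    then show "finite (set_pmf \<mu> \<times> {(h, k) \<in> F \<times> F. h \<noteq> k})"
      using E(1) F(1) finite_subset by blast
  next
    fix s assume "s \<in> set_pmf \<mu> \<times> {(h, k) \<in> F \<times> F. h \<noteq> k}"
    then obtain e h k where s: "s = (e, h, k)" and e: "e \<in> set_pmf \<mu>"
      and hk: "h \<in> F" "k \<in> F" "h \<noteq> k" by blast
    have "e \<otimes> (inv h \<otimes> k) \<otimes> inv e \<notin> ideal_Delta G \<phi> \<I> A"
      using sep[OF hk] mem_wreath_conj_iff[of "ideal_Delta G \<phi> \<I> A" "set_pmf \<mu>" "inv h \<otimes> k"]
        e hk E(2) F(3) by (auto simp: ideal_Delta_def subset_iff)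
    then show "(case s of (e, h, k) \<Rightarrow> \<phi> (h \<otimes> inv e) ` A \<inter> \<phi> (k \<otimes> inv e) ` A) \<in> \<I>"
      using e hk E(2) F(3) by (auto simp: s intro!: translates_Int_in_ideal[OF A])
  qed
  let ?\<nu> = "map_pmf (m_inv G) (pmf_of_set F)"
  have \<nu>: "?\<nu> \<in> fin_prob (carrier G)"
    using F by (auto simp: fin_prob_def)
  note \<mu>\<nu> = mult_in_fin_prob[OF \<mu> \<nu>]
  have "sis123 G X \<phi> B < \<epsilon>" using null[OF \<open>B \<in> \<I>\<close>] \<epsilon> by linarith
  then obtain \<rho> where \<rho>: "\<rho> \<in> fin_prob (carrier G)" and "\<And>x. x \<in> X \<Longrightarrow>
      measure_pmf.prob (orbit_pmf (pmf_convolution (\<otimes>) (return_pmf \<one>) \<rho>) x) B < \<epsilon>"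
    using sis123_less_obtain one_in_fin_prob by metis
  moreover have "pmf_convolution (\<otimes>) (return_pmf \<one>) \<rho> = \<rho>"
  proof -
    have "map_pmf ((\<otimes>) \<one>) \<rho> = map_pmf id \<rho>"
      using \<rho> by (intro map_pmf_cong) (auto dest: fin_probD)
    then show ?thesis
      by (simp add: pmf_convolution_bind_left bind_return_pmf)
  qed
  ultimately have small: "\<And>x. x \<in> X \<Longrightarrow> measure_pmf.prob (orbit_pmf \<rho> x) B < \<epsilon>" by simp
  have "c \<le> peak A (pmf_convolution (\<otimes>) \<mu> (pmf_convolution (\<otimes>) ?\<nu> \<rho>))"
    by (rule c[OF mult_in_fin_prob[OF \<nu> \<rho>]])
  also have "\<dots> \<le> 1 / card F + \<epsilon>"
    unfolding mult_pmf_assoc[OF \<mu> \<nu> \<rho>, symmetric]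
  proof (rule peak_le)
    fix x assume x: "x \<in> X"
    \<comment> \<open>On \<open>B\<close> the indicator alone covers the trivial bound 1; off
      \<open>B\<close> the translates are disjoint at \<open>y\<close>.\<close>
    have "measure_pmf.prob (orbit_pmf (pmf_convolution (\<otimes>) \<mu> ?\<nu>) y) A \<le> 1 / card F + indicator B y"
      if "y \<in> X" for y
    proof (cases "y \<in> B")
      case True
      then show ?thesis
        by (simp add: add_increasing)
    next
      case False
      then have "measure_pmf.prob (orbit_pmf (pmf_convolution (\<otimes>) \<mu> ?\<nu>) y) A \<le> 1 / card F"
        by (intro prob_uniform_inverse_le \<mu> F that) (force simp: B_def)
      then show ?thesis using False by simp
    qed
    then have "measure_pmf.prob (orbit_pmf (pmf_convolution (\<otimes>) (pmf_convolution (\<otimes>) \<mu> ?\<nu>) \<rho>) x) A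
        \<le> 1 / card F + measure_pmf.prob (orbit_pmf \<rho> x) B"
      unfolding orbit_pmf_mult_right[OF \<mu>\<nu> \<rho> x]
      using orbit_pmf_subset[OF \<rho> x] by (intro prob_bind_pmf_le_add) blast
    then show "measure_pmf.prob (orbit_pmf (pmf_convolution (\<otimes>) (pmf_convolution (\<otimes>) \<mu> ?\<nu>) \<rho>) x) A
        \<le> 1 / card F + \<epsilon>"
      using small[OF x] by linarith
  qed
  finally show "c \<le> 1 / card F + \<epsilon>" .
qed

section \<open>Covering the group by a maximal separated set\<close>

lemma cov_le_of_separated_card_le:
  assumes one: "\<one> \<in> D"
    and sym: "\<And>g. g \<in> carrier G \<Longrightarrow> g \<in> D \<Longrightarrow> inv g \<in> D"
    and D: "D \<subseteq> carrier G"
    and bound: "\<And>F. \<lbrakk>finite F; F \<noteq> {}; F \<subseteq> carrier G;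
      \<And>h k. \<lbrakk>h \<in> F; k \<in> F; h \<noteq> k\<rbrakk> \<Longrightarrow> inv h \<otimes> k \<notin> D\<rbrakk> \<Longrightarrow> card F \<le> n"
  shows "cov G D \<le> enat n"
proof -
  interpret group G by (rule group_G)
  define separated where "separated F \<longleftrightarrow> finite F \<and> F \<subseteq> carrier G \<and>
    (\<forall>h\<in>F. \<forall>k\<in>F. h \<noteq> k \<longrightarrow> inv h \<otimes> k \<notin> D)" for F
  \<comment> \<open>\<open>bound\<close> speaks of non-empty sets only, whereas the search for a
    largest separated set starts from the empty one.\<close>
  have bound': "card F \<le> n" if "separated F" for F
    using bound[of F] that by (cases "F = {}") (auto simp: separated_def)
  have "separated {}" by (simp add: separated_def)
  then have "\<exists>F. separated F \<and> (\<forall>F'. separated F' \<longrightarrow> card F' \<le> card F)"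
    by (rule ex_has_greatest_nat[where b = "Suc n"]) (simp add: bound' less_Suc_eq_le)
  then obtain F where F: "separated F" and max: "\<And>F'. separated F' \<Longrightarrow> card F' \<le> card F"
    by blast
  have F_sub: "F \<subseteq> carrier G" and F_fin: "finite F" using F by (auto simp: separated_def)
  have near: "\<exists>h\<in>F. inv h \<otimes> g \<in> D" if g: "g \<in> carrier G" for g
  proof (rule ccontr)
    assume *: "\<not> ?thesis"
    then have "g \<notin> F" using one g by (auto simp: l_inv)
    \<comment> \<open>Separation concerns both orders of a pair, while the assumption on
      \<open>g\<close> gives just one; symmetry of \<open>D\<close> supplies the other.\<close>
    have "inv g \<otimes> h \<notin> D" if "h \<in> F" for h
    proof
      assume "inv g \<otimes> h \<in> D"
      then have "inv (inv g \<otimes> h) \<in> D" using sym D by blast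
      moreover have "inv (inv g \<otimes> h) = inv h \<otimes> g"
        using g that F_sub by (auto simp: inv_mult_group subset_iff)
      ultimately show False using * that by auto
    qed
    then have "separated (insert g F)"
      using * F g by (auto simp: separated_def)
    from max[OF this] \<open>g \<notin> F\<close> F_fin show False by simp
  qed
  have "carrier G = F <#> D"
  proof (intro equalityI subsetI)
    fix g assume g: "g \<in> carrier G"
    then obtain h where h: "h \<in> F" "inv h \<otimes> g \<in> D" using near by blast
    then have "h \<in> carrier G" using F_sub by blast
    then have "g = h \<otimes> (inv h \<otimes> g)" using g by (simp add: m_assoc[symmetric])
    with h show "g \<in> F <#> D" unfolding set_mult_def by blast
  next
    fix g assume "g \<in> F <#> D"
    then show "g \<in> carrier G" using set_mult_closed[OF F_sub D] by blast
  qed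
  then have "cov G D \<le> set_size F"
    unfolding cov_def using F_sub by (intro INF_lower) blast
  also have "\<dots> \<le> enat n"
    using F_fin bound'[OF F] by (simp add: set_size_def)
  finally show ?thesis .
qed

section \<open>From a dense cell to the covering number\<close>

lemma cov_wreath_conj_ideal_Delta_le:
  assumes A: "A \<subseteq> X"
    and null: "\<And>B. B \<in> \<I> \<Longrightarrow> sis123 G X \<phi> B \<le> 0"
    and dense: "1 / (real n + 1) < sis123 G X \<phi> A"
  shows "\<exists>E. finite E \<and> E \<subseteq> carrier G \<and> cov G (wreath_conj G (ideal_Delta G \<phi> \<I> A) E) \<le> enat n"
proof -
  interpret group G by (rule group_G)
  obtain \<mu> c where \<mu>: "\<mu> \<in> fin_prob (carrier G)" and c: "1 / (real n + 1) < c"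
    and peak: "\<And>\<nu>. \<nu> \<in> fin_prob (carrier G) \<Longrightarrow> c \<le> peak A (pmf_convolution (\<otimes>) \<mu> \<nu>)"
    using less_sis123_obtain[OF dense] by metis
  have E: "finite (set_pmf \<mu>)" "set_pmf \<mu> \<subseteq> carrier G"
    using \<mu> by (auto simp: fin_prob_def)
  let ?D = "wreath_conj G (ideal_Delta G \<phi> \<I> A) (set_pmf \<mu>)"
  have sub: "ideal_Delta G \<phi> \<I> A \<subseteq> carrier G" by (auto simp: ideal_Delta_def)
  have "0 < 1 / (real n + 1)" by simp
  \<comment> \<open>Positive density keeps \<open>A\<close> out of the ideal, which puts
    \<open>\<one>\<close> into the difference set and hence into \<open>?D\<close>.\<close>
  then have "A \<notin> \<I>" using null[of A] dense by linarith
  then have "\<one> \<in> ideal_Delta G \<phi> \<I> A"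
    by (simp add: ideal_Delta_def image_action_one[OF A])
  moreover obtain e where "e \<in> set_pmf \<mu>" using set_pmf_not_empty[of \<mu>] by blast
  ultimately have one: "\<one> \<in> ?D"
    using E(2) by (subst mem_wreath_conj_iff[OF sub E(2)]) (auto intro!: bexI[of _ e] simp: subset_iff)
  have "cov G ?D \<le> enat n"
  proof (rule cov_le_of_separated_card_le[OF one])
    show "?D \<subseteq> carrier G"
      using E(2) sub by (auto simp: wreath_conj_def subset_iff)
  next
    fix F assume F: "finite F" "F \<noteq> {}" "F \<subseteq> carrier G"
      "\<And>h k. \<lbrakk>h \<in> F; k \<in> F; h \<noteq> k\<rbrakk> \<Longrightarrow> inv h \<otimes> k \<notin> ?D"
    \<comment> \<open>The strict inequality gives \<open>card F < n + 1\<close>, and integrality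
      turns this into \<open>card F \<le> n\<close>.\<close>
    have "1 / (real n + 1) < 1 / card F"
      using c card_le_of_peak[OF A \<mu> null peak F] by linarith
    moreover have "0 < card F" using F by (simp add: card_gt_0_iff)
    ultimately have "real (card F) < real n + 1" by (simp add: field_simps)
    then show "card F \<le> n" by linarith
  qed (rule inv_mem_wreath_conj[OF A E(2)])
  with E show ?thesis by blast
qed

end

theorem corollary7p7:
  fixes G :: "('g, 'b) monoid_scheme"
    and X :: "'x set"
    and \<phi> :: "'g \<Rightarrow> 'x \<Rightarrow> 'x"
    and \<I> :: "'x set set"
    and A :: "nat \<Rightarrow> 'x set"
    and n :: nat
  assumes "group G"
    and "ideal_G_space G X \<phi> \<I>"
    and "\<And>B. B \<in> \<I> \<Longrightarrow> sis123 G X \<phi> B = 0"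
    and "X = (\<Union>i\<in>{1..n}. A i)"
    and "disjoint_family_on A {1..n}"
  shows "\<exists>i\<in>{1..n}. \<exists>E. finite E \<and> E \<subseteq> carrier G \<and>
           cov G (wreath_conj G (ideal_Delta G \<phi> \<I> (A i)) E) \<le> enat n"
proof -
  interpret ideal_G_space G X \<phi> \<I> by (rule assms(2))
  \<comment> \<open>The threshold lies strictly below \<open>1/n\<close>, leaving room to extract
    \<open>\<mu>1\<close>. If no cell exceeded it, the total would be at most
    \<open>n / (n + 1) < 1\<close>; this argument also rules out \<open>n = 0\<close>.\<close>
  have "\<exists>i\<in>{1..n}. 1 / (real n + 1) < sis123 G X \<phi> (A i)"
  proof (rule ccontr)
    assume "\<not> ?thesis"
    then have "(\<Sum>i\<in>{1..n}. sis123 G X \<phi> (A i)) \<le> (\<Sum>i\<in>{1..n}. 1 / (real n + 1))"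
      by (intro sum_mono) (auto simp: not_less)
    also have "\<dots> < 1" by (simp add: field_simps)
    finally show False
      using sis123_UN_le[of "{1..n}" A] sis123_space_ge assms(4) by simp
  qed
  then obtain i where i: "i \<in> {1..n}" "1 / (real n + 1) < sis123 G X \<phi> (A i)" by blast
  have "A i \<subseteq> X" using i(1) assms(4) by blast
  then have "\<exists>E. finite E \<and> E \<subseteq> carrier G \<and>
      cov G (wreath_conj G (ideal_Delta G \<phi> \<I> (A i)) E) \<le> enat n"
    by (rule cov_wreath_conj_ideal_Delta_le) (simp_all add: i(2) assms(3))
  with i(1) show ?thesis by (rule bexI[rotated])
qed

end
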